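(* Let $p$ and $\beta$ be real numbers with $p\ge 1$, $\beta>0$ and $p/\beta\le 2$. Then $$B(p,\beta)^{1/p}\ \ge\ K_-\cdot\beta,\qquad\text{where } K_-=(2\pi)^{-1/2}\,\exp\left[-\frac{1}{2e}+\frac13\right].$$
   Context: The Bell function of two variables is $B(p,\beta)=e^{-\beta}\sum_{k=0}^{\infty}\frac{k^p\,\beta^k}{k!}$ for real $p>0$ and $\beta>0$. Equivalently, $B(p,\beta)={\bf E}(\tau^p)$ where $\tau$ is a Poisson random variable with parameter $\beta$. *)

theory Defs
  imports Complex_Main
begin

text \<open>The Bell function of two variables, intended for \<open>p > 0\<close> and \<open>\<beta> > 0\<close>.
  The term for \<open>k = 0\<close> vanishes because \<open>0 powr p = 0\<close>, which agrees with
  \<open>0\<close> to the power \<open>p\<close> for \<open>p > 0\<close>.\<close>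

definition Bell :: "real \<Rightarrow> real \<Rightarrow> real" where
  "Bell p \<beta> = exp (- \<beta>) * (\<Sum>k. real k powr p * \<beta> ^ k / fact k)"

definition K_minus :: real where
  "K_minus = (2 * pi) powr (- 1 / 2) * exp (- 1 / (2 * exp 1) + 1 / 3)"

end

theory Submission
  imports Defs "HOL-Analysis.Convex"
begin

text \<open>Jensen's inequality for the Poisson distribution already gives
  \<open>Bell p \<beta> \<ge> \<beta> powr p\<close> for every \<open>p \<ge> 1\<close>: sum the tangent line of \<open>x powr p\<close>
  at \<open>\<beta>\<close>, whose linear part vanishes because the mean is \<open>\<beta>\<close>. The claim follows
  since \<open>K_minus \<le> 1\<close>.\<close>

text \<open>Bernoulli's inequality for real exponents. It is weighted AM-GM (Young) for the numbers
  \<open>t powr p\<close> and 1 with weights \<open>1 / p\<close> and \<open>1 - 1 / p\<close>,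
  multiplied by \<open>p\<close>. Young is applied to positive numbers, so \<open>t = 0\<close> is
  treated separately.\<close>

lemma one_plus_mult_le_powr:
  fixes p t :: real
  assumes "p \<ge> 1" and "t \<ge> 0"
  shows "1 + p * (t - 1) \<le> t powr p"
proof (cases "t = 0")
  case True
  then show ?thesis using assms by simp
next
  case False
  then have "(t powr p) powr (1 / p) * 1 powr (1 - 1 / p) \<le> 1 / p * t powr p + (1 - 1 / p) * 1"
    using assms by (intro Youngs_inequality_0) auto
  then have "t \<le> t powr p / p + (1 - 1 / p)" using assms by (simp add: powr_powr)
  then have "p * t \<le> p * (t powr p / p + (1 - 1 / p))" using assms by (intro mult_left_mono) auto
  also have "\<dots> = t powr p + p - 1" using assms by (simp add: distrib_left right_diff_distrib)
  finally show ?thesis by (simp add: right_diff_distrib)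
qed

text \<open>From k \<le> exp k follows \<open>real k powr p \<le> exp p ^ k\<close>, so the
  exponential series at \<open>\<beta> * exp p\<close> is a majorant.\<close>

lemma summable_Bell:
  fixes p \<beta> :: real
  assumes "p \<ge> 0" and "\<beta> \<ge> 0"
  shows "summable (\<lambda>k. real k powr p * \<beta> ^ k / fact k)"
proof (rule summable_comparison_test')
  show "summable (\<lambda>k. (\<beta> * exp p) ^ k /\<^sub>R fact k)" by (rule summable_exp_generic)
  fix k :: nat
  have "real k powr p \<le> exp (real k) powr p"
    using assms(1) exp_ge_add_one_self[of "real k"] by (intro powr_mono2) linarith+
  also have "\<dots> = exp p ^ k" by (simp add: powr_def exp_of_nat_mult[symmetric] mult.commute)
  finally have "real k powr p * \<beta> ^ k / fact k \<le> exp p ^ k * \<beta> ^ k / fact k"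
    using assms(2) by (intro divide_right_mono mult_right_mono) auto
  then show "norm (real k powr p * \<beta> ^ k / fact k) \<le> (\<beta> * exp p) ^ k /\<^sub>R fact k"
    using assms by (simp add: power_mult_distrib field_simps)
qed

lemma Bell_ge_powr:
  fixes p \<beta> :: real
  assumes "p \<ge> 1" and "\<beta> > 0"
  shows "\<beta> powr p \<le> Bell p \<beta>"
proof -
  have exp_sums: "(\<lambda>k. \<beta> ^ k / fact k) sums exp \<beta>"
    using exp_converges[of \<beta>] by (simp add: field_simps)
  \<comment> \<open>The factor \<open>Suc k\<close> cancels against \<open>fact (Suc k)\<close>,
    leaving \<beta> times the exponential series. Shifting back costs nothing because the term at 0
    vanishes.\<close>
  have "(\<lambda>k. real (Suc k) * \<beta> ^ Suc k / fact (Suc k)) sums (\<beta> * exp \<beta>)"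
    using sums_mult[OF exp_sums, of \<beta>] by (simp add: field_simps del: of_nat_Suc)
  then have mean_sums: "(\<lambda>k. real k * \<beta> ^ k / fact k) sums (\<beta> * exp \<beta>)"
    by (subst (asm) sums_Suc_iff) simp
  \<comment> \<open>The tangent line at \<beta>, evaluated at k, is
    \<open>\<beta> powr p * ((1 - p) + p / \<beta> * k)\<close>. Weighted by
    \<open>\<beta> ^ k / fact k\<close>, it splits into the two series just summed.\<close>
  have tangent_sums: "(\<lambda>k. \<beta> powr p * ((1 - p) * (\<beta> ^ k / fact k) + p / \<beta> * (real k * \<beta> ^ k / fact k)))
      sums (\<beta> powr p * ((1 - p) * exp \<beta> + p / \<beta> * (\<beta> * exp \<beta>)))"
    by (intro sums_mult sums_add exp_sums mean_sums)
  have "\<beta> powr p * ((1 - p) * exp \<beta> + p / \<beta> * (\<beta> * exp \<beta>)) \<le> (\<Sum>k. real k powr p * \<beta> ^ k / fact k)"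
  proof (rule sums_le[OF _ tangent_sums])
    show "(\<lambda>k. real k powr p * \<beta> ^ k / fact k) sums (\<Sum>k. real k powr p * \<beta> ^ k / fact k)"
      using assms by (intro summable_sums summable_Bell) auto
    fix k :: nat
    \<comment> \<open>Bernoulli at \<open>t = k / \<beta>\<close>, scaled by
      \<open>\<beta> powr p\<close>, says that the tangent line lies below \<open>x powr p\<close>
      at \<open>x = k\<close>.\<close>
    have "1 + p * (real k / \<beta> - 1) \<le> real k powr p / \<beta> powr p"
      using one_plus_mult_le_powr[of p "real k / \<beta>"] assms by (simp add: powr_divide)
    then have "\<beta> powr p * (1 + p * (real k / \<beta> - 1)) \<le> real k powr p"
      using assms by (simp add: field_simps)
    then have "\<beta> powr p * (1 + p * (real k / \<beta> - 1)) * (\<beta> ^ k / fact k) \<le> real k powr p * (\<beta> ^ k / fact k)"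
      using assms by (intro mult_right_mono) auto
    then show "\<beta> powr p * ((1 - p) * (\<beta> ^ k / fact k) + p / \<beta> * (real k * \<beta> ^ k / fact k))
        \<le> real k powr p * \<beta> ^ k / fact k"
      by (simp add: algebra_simps add_divide_distrib diff_divide_distrib)
  qed
  also have "\<beta> powr p * ((1 - p) * exp \<beta> + p / \<beta> * (\<beta> * exp \<beta>)) = \<beta> powr p * exp \<beta>"
    using assms by (simp add: field_simps)
  finally show ?thesis
    by (simp add: Bell_def exp_minus field_simps)
qed

lemma K_minus_le_1: "K_minus \<le> 1"
proof -
  \<comment> \<open>Since e \<le> 3 and 2 \<le> pi, \<open>ln (2 * pi)\<close> is at least 1. Hence
    the logarithm of \<open>K_minus\<close> is at most -1/2 + 1/3 < 0.\<close>
  have "exp 1 \<le> 2 * pi" using exp_le pi_ge_two by linarith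
  then have "1 \<le> ln (2 * pi)" by (simp add: ln_ge_iff)
  moreover have "0 \<le> 1 / (2 * exp (1::real))" by simp
  ultimately have "(- 1 / 2) * ln (2 * pi) + (- 1 / (2 * exp 1) + 1 / 3) \<le> 0" by linarith
  moreover have "K_minus = exp ((- 1 / 2) * ln (2 * pi) + (- 1 / (2 * exp 1) + 1 / 3))"
    unfolding K_minus_def by (subst exp_add) (simp add: powr_def)
  ultimately show ?thesis by (metis exp_le_one_iff)
qed

theorem proposition6p1:
  fixes p \<beta> :: real
  assumes "p \<ge> 1" and "\<beta> > 0" and "p / \<beta> \<le> 2"
  shows "Bell p \<beta> powr (1 / p) \<ge> K_minus * \<beta>"
proof -
  have "K_minus * \<beta> \<le> \<beta>" using K_minus_le_1 assms(2) by simp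
  also have "\<beta> = (\<beta> powr p) powr (1 / p)" using assms by (simp add: powr_powr)
  also have "\<dots> \<le> Bell p \<beta> powr (1 / p)"
    using assms Bell_ge_powr[of p \<beta>] by (intro powr_mono2) auto
  finally show ?thesis .
qed

end
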